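(* Let $f(x)\in\mathbb{F}_q[x]$ be a nonconstant polynomial and $n\geq 1$ be an integer such that $y^n-f(x)\notin\mathbb{F}_q[x^p,y^p]$. Then the irreducible components of the curve $\mathcal{F}: y^n=f(x)$ are $q$-Frobenius nonclassical if and only if $n\mid q-1$ and $$n\cdot f(x)\big(f(x)^{\frac{q-1}{n}}-1\big)=(x^q-x)f'(x).$$
   Context: $p$ is a prime and $q$ is a power of $p$; $\overline{\mathbb{F}_q}$ is the algebraic closure of $\mathbb{F}_q$; $f'$ is the formal derivative. The irreducible components of a plane curve $G(x,y)=0$ are the curves $G_i=0$, where the $G_i$ are the irreducible factors of $G$ in $\overline{\mathbb{F}_q}[x,y]$. An (absolutely) irreducible plane curve $F(x,y)=0$ defined over $\mathbb{F}_q$ (i.e. with $F\in\mathbb{F}_q[x,y]$, up to a nonzero constant) is called $q$-Frobenius nonclassical if $F$ divides $(x^q-x)\frac{\partial F}{\partial x}+(y^q-y)\frac{\partial F}{\partial y}$; in particular, saying that the components are $q$-Frobenius nonclassical includes that they are defined over $\mathbb{F}_q$. *)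

theory Defs
  imports "HOL-Library.Cardinality" "HOL-Algebra.Algebraic_Closure_Type"
begin

text \<open>
  The finite field with \<open>q\<close> elements is a type \<open>'a\<close> of sort \<open>{finite, field}\<close> with
  \<open>CARD('a) = q\<close>, and its algebraic closure is \<open>'a alg_closure\<close>. A polynomial in \<open>k[x,y]\<close> is an
  element of \<open>k[x][y]\<close>, of type \<open>'k poly poly\<close>: the inner variable is \<open>x\<close>, the outer one is \<open>y\<close>.
  A plane curve is represented by a polynomial defining it; all notions below are invariant under
  multiplying that polynomial by a nonzero constant.
\<close>

definition var_x :: "'k::comm_ring_1 poly poly" where
  "var_x = [:[:0, 1:]:]"

definition var_y :: "'k::comm_ring_1 poly poly" where
  "var_y = [:0, 1:]"

definition partial_x :: "'k::idom poly poly \<Rightarrow> 'k poly poly" where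
  "partial_x F = map_poly pderiv F"

definition partial_y :: "'k::idom poly poly \<Rightarrow> 'k poly poly" where
  "partial_y F = pderiv F"

definition powers_subring :: "nat \<Rightarrow> 'k::comm_ring_1 poly poly set" where
  \<comment> \<open>the subring \<open>k[x\<^sup>m, y\<^sup>m]\<close>, as the set of all \<open>H(x\<^sup>m, y\<^sup>m)\<close>\<close>
  "powers_subring m =
     range (\<lambda>H. pcompose (map_poly (\<lambda>c. pcompose c (Polynomial.monom 1 m)) H)
                         (Polynomial.monom 1 m))"

definition to_closure :: "'a::field poly poly \<Rightarrow> 'a alg_closure poly poly" where
  "to_closure F = map_poly (map_poly to_ac) F"

definition irreducible_components :: "'k::field poly poly \<Rightarrow> 'k poly poly set" where
  \<comment> \<open>meant for \<open>k\<close> algebraically closed; each component occurs with all its scalar multiples\<close>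
  "irreducible_components F = {G. Factorial_Ring.irreducible G \<and> G dvd F}"

definition defined_over_base :: "'a::field alg_closure poly poly \<Rightarrow> bool" where
  "defined_over_base G \<longleftrightarrow> (\<exists>c G0. c \<noteq> 0 \<and> Polynomial.smult [:c:] G = to_closure G0)"

definition Frobenius_nonclassical :: "'a::{finite, field} alg_closure poly poly \<Rightarrow> bool" where
  \<comment> \<open>\<open>q\<close>-Frobenius nonclassical for \<open>q = CARD('a)\<close>\<close>
  "Frobenius_nonclassical G \<longleftrightarrow>
     Factorial_Ring.irreducible G \<and> defined_over_base G \<and>
     G dvd (var_x ^ CARD('a) - var_x) * partial_x G + (var_y ^ CARD('a) - var_y) * partial_y G"

definition superelliptic :: "nat \<Rightarrow> 'k::comm_ring_1 poly \<Rightarrow> 'k poly poly" where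
  \<comment> \<open>the polynomial \<open>y\<^sup>n - f(x)\<close>\<close>
  "superelliptic n f = var_y ^ n - [:f:]"

end

(*
Let D = (x^q - x) d/dx + (y^q - y) d/dy and F = y^n - f. As D is a derivation, F divides D F as soon
as each irreducible factor G divides D G. Reducing D F modulo y^n = f with q - 1 = n s + t, t < n,
leaves n f^(s+1) y^t - n f - (x^q - x) f', of degree < n in y; it vanishes iff t = 0 and the identity
holds (for t > 0 it would give n = 0 and f' = 0, so that F would lie in the excluded subring).

Conversely, the identity bounds deg f by n < q, so f(a) is nonzero for some a in F_q, and evaluating
the identity at a gives f(a)^s = 1. The zeros b of F(a, y) = y^n - f(a) are therefore simple and
satisfy b^q = b. Simplicity shows that no irreducible factor G divides its cofactor H = F / G, whence
G divides D G from G | G D H + H D G. Likewise the Frobenius conjugate M' of the factor M normalised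
to be monic in y has the zeros (a, b) of M; if M divided the conjugate of its cofactor, then M M' would
divide F and (a, b) would be a double zero. Hence M divides M', so M = M' has coefficients in F_q.
*)
theory Submission
  imports Defs "HOL-Number_Theory.Residues"
begin

section \<open>Ring homomorphisms and polynomials\<close>

text \<open>Common interface for the embedding \<open>to_ac\<close>, evaluation, substitution and
  the Frobenius power; it passes to coefficientwise maps, hence to k[x] and k[x][y].\<close>

locale ring_map =
  fixes h :: "'a::comm_ring_1 \<Rightarrow> 'b::comm_ring_1"
  assumes map_one: "h 1 = 1"
    and map_add: "h (x + y) = h x + h y"
    and map_mult: "h (x * y) = h x * h y"
begin

lemma map_zero: "h 0 = 0"
  using map_add[of 0 0] by simp

lemma map_minus: "h (- x) = - h x"
  using map_add[of x "- x"] by (simp add: map_zero eq_neg_iff_add_eq_0 add.commute)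

lemma map_diff: "h (x - y) = h x - h y"
  using map_add[of x "- y"] by (simp add: map_minus)

lemma map_power: "h (x ^ m) = h x ^ m"
  by (induction m) (simp_all add: map_one map_mult)

lemma map_of_nat: "h (of_nat m) = of_nat m"
  by (induction m) (simp_all add: map_one map_zero map_add)

lemma map_poly_ring_map: "ring_map (map_poly h)"
proof
  show add: "map_poly h (P + Q) = map_poly h P + map_poly h Q" for P Q
    by (intro poly_eqI) (simp add: coeff_map_poly map_zero map_add)
  show "map_poly h (P * Q) = map_poly h P * map_poly h Q" for P Q
    by (induction P)
      (simp_all add: add map_poly_smult map_poly_pCons map_zero map_mult)
qed (simp add: map_one)

lemma poly_map_poly: "poly (map_poly h P) (h x) = h (poly P x)"
  by (induction P) (simp_all add: map_poly_pCons map_zero map_add map_mult)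

end

lemma to_ac_ring_map: "ring_map to_ac"
  by unfold_locales simp_all

lemma poly_eval_ring_map: "ring_map (\<lambda>c. poly c a)"
  by unfold_locales simp_all

lemma pcompose_ring_map: "ring_map (\<lambda>c. pcompose c R)"
  by unfold_locales (simp_all add: pcompose_1 pcompose_add pcompose_mult)

text \<open>Relates the fibre polynomial over \<open>x = a\<close>, in \<open>y\<close> alone, to
  values at points \<open>(a, b)\<close>.\<close>

lemma poly_map_poly_eval:
  "poly (map_poly (\<lambda>c. poly c a) P) b = poly (poly P [:b:]) (a :: 'k::comm_ring_1)"
  using ring_map.poly_map_poly[OF poly_eval_ring_map, of a P "[:b:]"] by simp

section \<open>The derivation attached to the Frobenius map\<close>

lemma partial_x_mult: "partial_x (P * Q) = P * partial_x Q + Q * partial_x P"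
proof -
  have add: "map_poly pderiv (P + Q) = map_poly pderiv P + map_poly pderiv Q"
    for P Q :: "'a poly poly"
    by (intro poly_eqI) (simp add: coeff_map_poly pderiv_add)
  have smult: "map_poly pderiv (Polynomial.smult c Q) =
      Polynomial.smult c (map_poly pderiv Q) + Polynomial.smult (pderiv c) Q"
    for c and Q :: "'a poly poly"
    by (intro poly_eqI) (simp add: coeff_map_poly pderiv_mult mult.commute)
  show ?thesis
    unfolding partial_x_def
    by (induction P) (simp_all add: add smult map_poly_pCons algebra_simps)
qed

text \<open>The expression tested in \<open>Frobenius_nonclassical\<close>, isolated because it
  obeys the Leibniz rule in \<open>G\<close>.\<close>

definition Frobenius_derivation :: "nat \<Rightarrow> 'k::idom poly poly \<Rightarrow> 'k poly poly"
  where
  "Frobenius_derivation q G =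
     (var_x ^ q - var_x) * partial_x G + (var_y ^ q - var_y) * partial_y G"

lemma Frobenius_derivation_mult:
  "Frobenius_derivation q (P * Q) =
     P * Frobenius_derivation q Q + Q * Frobenius_derivation q P"
  unfolding Frobenius_derivation_def
  by (simp add: partial_x_mult partial_y_def pderiv_mult algebra_simps)

lemma Frobenius_derivation_unit:
  assumes "is_unit (G :: 'k::field poly poly)"
  shows "Frobenius_derivation q G = 0"
proof -
  obtain c where "G = [:[:c:]:]"
    using assms by (auto simp: is_unit_poly_iff)
  then show ?thesis
    by (simp add: Frobenius_derivation_def partial_x_def partial_y_def map_poly_pCons
        pderiv_pCons)
qed

text \<open>In \<open>D(GH) = G DH + H DG\<close> both summands are divisible by \<open>GH\<close>
  once \<open>G | DG\<close> and \<open>H | DH\<close>, so induction over prime factors works even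
  with repeated ones.\<close>

lemma dvd_Frobenius_derivation:
  fixes F :: "'k::{field, factorial_ring_gcd, semiring_gcd_mult_normalize} poly poly"
  assumes "\<And>G. Factorial_Ring.irreducible G \<Longrightarrow> G dvd F \<Longrightarrow> G dvd Frobenius_derivation q G"
  shows "F dvd Frobenius_derivation q F"
  using assms
proof (induction F rule: prime_divisors_induct)
  case zero
  then show ?case
    by (simp add: Frobenius_derivation_def partial_x_def partial_y_def)
next
  case (unit x)
  then show ?case by (simp add: Frobenius_derivation_unit)
next
  case (factor G H)
  have "G dvd Frobenius_derivation q G"
    using factor(1,3) by (simp add: prime_elem_imp_irreducible prime_imp_prime_elem)
  moreover have "H dvd Frobenius_derivation q H"
    using factor(2,3) by simp
  ultimately show ?case
    unfolding Frobenius_derivation_mult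
    by (intro dvd_add) (auto simp: mult_dvd_mono mult.commute[of G H])
qed

section \<open>The polynomial \<open>y ^ n - f\<close>\<close>

lemma var_y_power: "var_y ^ n = Polynomial.monom 1 n"
  by (simp add: var_y_def monom_altdef)

lemma degree_superelliptic:
  assumes "n \<ge> 1"
  shows "Polynomial.degree (superelliptic n f) = n"
    and "lead_coeff (superelliptic n f) = 1"
proof -
  have "Polynomial.degree (superelliptic n f) = n"
    using assms by (intro antisym degree_le le_degree)
      (auto simp: superelliptic_def var_y_power coeff_pCons split: nat.split)
  then show "Polynomial.degree (superelliptic n f) = n"
    and "lead_coeff (superelliptic n f) = 1"
    using assms by (auto simp: superelliptic_def var_y_power coeff_pCons split: nat.split)
qed

lemma poly_superelliptic: "poly (poly (superelliptic n f) [:b:]) a = b ^ n - poly f a"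
  by (simp add: superelliptic_def var_y_def)

lemma partial_y_superelliptic:
  "partial_y (superelliptic n f :: 'k::idom poly poly) = of_nat n * var_y ^ (n - 1)"
proof -
  have "partial_y (superelliptic n f) = Polynomial.monom (of_nat n) (n - 1)"
    by (simp add: superelliptic_def partial_y_def var_y_power pderiv_diff pderiv_monom)
  also have "\<dots> = of_nat n * Polynomial.monom 1 (n - 1)"
    by (simp add: of_nat_poly Polynomial.smult_monom)
  finally show ?thesis
    by (simp add: var_y_power)
qed

lemma partial_x_superelliptic:
  "partial_x (superelliptic n f :: 'k::idom poly poly) = - [:pderiv f:]"
  by (intro poly_eqI)
    (simp add: superelliptic_def partial_x_def var_y_power coeff_map_poly pderiv_diff
      coeff_pCons split: nat.split)

lemma map_poly_superelliptic:
  assumes "ring_map h"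
  shows "map_poly (map_poly h) (superelliptic n f) = superelliptic n (map_poly h f)"
proof -
  interpret h: ring_map h by fact
  interpret ring_map "map_poly h" by (rule h.map_poly_ring_map)
  interpret hh: ring_map "map_poly (map_poly h)" by (rule map_poly_ring_map)
  show ?thesis
    by (simp add: superelliptic_def hh.map_diff var_y_power map_poly_monom map_zero map_one
        map_poly_pCons)
qed

text \<open>The factor \<open>y^(n-1)\<close> of the \<open>y\<close>-derivative is absorbed into
  \<open>y^q - y\<close>, which exposes \<open>y^n\<close> for replacement by
  \<open>f\<close>.\<close>

lemma Frobenius_derivation_superelliptic:
  fixes f :: "'k::idom poly"
  assumes "n \<ge> 1" "q \<ge> 1"
  shows "Frobenius_derivation q (superelliptic n f) =
    of_nat n * (var_y ^ n * var_y ^ (q - 1) - var_y ^ n) -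
    [:([:0, 1:] ^ q - [:0, 1:]) * pderiv f:]"
proof -
  obtain m r where mr: "n = Suc m" "q = Suc r"
    using assms by (cases n; cases q) auto
  have "var_x ^ q - var_x = [:[:0, 1:] ^ q - [:0, 1:] :: 'k poly:]"
    by (simp add: var_x_def poly_const_pow)
  then show ?thesis
    unfolding Frobenius_derivation_def partial_x_superelliptic partial_y_superelliptic
    by (simp add: mr algebra_simps)
qed

section \<open>Reduction modulo \<open>y^n = f\<close>\<close>

lemma diff_dvd_power_diff: "a - b dvd a ^ m - (b :: 'k::comm_ring_1) ^ m"
  by (metis dvd_triv_left power_diff_sumr2)

lemma superelliptic_dvd_power_diff:
  "superelliptic n f dvd (var_y ^ n) ^ m - [:f:] ^ m"
  unfolding superelliptic_def by (rule diff_dvd_power_diff)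

text \<open>As \<open>y^n - f\<close> is monic of degree \<open>n\<close> in \<open>y\<close>, a
  multiple of smaller degree in \<open>y\<close> is zero; both conclusions are read off the
  coefficients of the remainder \<open>R\<close>.\<close>

lemma superelliptic_dvd_Frobenius_derivationD:
  fixes f :: "'k::idom poly"
  assumes n: "n \<ge> 1" and q: "q > 1" and f: "f \<noteq> 0"
    and sep: "of_nat n \<noteq> (0 :: 'k) \<or> pderiv f \<noteq> 0"
    and dvd: "superelliptic n f dvd Frobenius_derivation q (superelliptic n f)"
  shows "n dvd q - 1"
    and "of_nat n * f * (f ^ ((q - 1) div n) - 1) = ([:0, 1:] ^ q - [:0, 1:]) * pderiv f"
proof -
  define s t where "s = (q - 1) div n" and "t = (q - 1) mod n"
  define w where "w = ([:0, 1:] ^ q - [:0, 1:]) * pderiv f"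
  \<comment> \<open>The remainder: \<open>y^n y^(q-1)\<close> is \<open>(y^n)^(s+1) y^t\<close>, and
    each \<open>y^n\<close> becomes \<open>f\<close>.\<close>
  define R where "R = Polynomial.monom (of_nat n * f ^ Suc s) t - [:of_nat n * f + w:]"
  have qnt: "q - 1 = n * s + t" and t: "t < n"
    using n by (simp_all add: s_def t_def)
  \<comment> \<open>The exponent 1 gives both differences the shape of
    \<open>superelliptic_dvd_power_diff\<close>.\<close>
  have "Frobenius_derivation q (superelliptic n f) - R =
      of_nat n * (((var_y ^ n) ^ Suc s - [:f:] ^ Suc s) * var_y ^ t -
      ((var_y ^ n) ^ 1 - [:f:] ^ 1))"
  proof -
    have "Polynomial.monom (of_nat n * f ^ Suc s) t = of_nat n * [:f:] ^ Suc s * var_y ^ t"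
      by (simp add: monom_altdef var_y_def of_nat_poly poly_const_pow del: power_Suc)
    moreover have "[:of_nat n * f + w:] = of_nat n * [:f:] + [:w:]"
      by (simp add: of_nat_poly)
    ultimately have R': "R = of_nat n * [:f:] ^ Suc s * var_y ^ t - (of_nat n * [:f:] + [:w:])"
      by (simp only: R_def)
    have "var_y ^ n * var_y ^ (q - 1) = (var_y ^ n) ^ Suc s * (var_y ^ t :: 'k poly poly)"
      by (simp only: qnt power_add power_mult power_Suc mult.assoc)
    then have D: "Frobenius_derivation q (superelliptic n f) =
        of_nat n * ((var_y ^ n) ^ Suc s * var_y ^ t - var_y ^ n) - [:w:]"
      using Frobenius_derivation_superelliptic[OF n, of q f] q by (simp only: w_def)
    show ?thesis
      unfolding R' D power_one_right by (simp only: algebra_simps)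
  qed
  moreover have "superelliptic n f dvd \<dots>"
    by (intro dvd_mult dvd_diff dvd_mult2 superelliptic_dvd_power_diff)
  ultimately have "superelliptic n f dvd R"
    using dvd by (metis dvd_diff_right_iff)
  moreover have "Polynomial.degree R < n"
    unfolding R_def using t
    by (intro degree_diff_less) (auto intro: le_less_trans[OF degree_monom_le])
  ultimately have R: "R = 0"
    using dvd_imp_degree_le[of "superelliptic n f" R] degree_superelliptic[OF n, of f] by auto
  have x: "[:0, 1:] ^ q - [:0, 1:] \<noteq> (0 :: 'k poly)"
  proof -
    have "Polynomial.coeff [:0, 1 :: 'k:] q = 0"
      using q by (simp add: coeff_pCons split: nat.split)
    then show ?thesis
      using coeff_linear_power[of "0 :: 'k" q] by auto
  qed
  \<comment> \<open>For \<open>t > 0\<close> the two terms of \<open>R\<close> have different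
    degrees in \<open>y\<close>, so both vanish; as \<open>f\<close> and \<open>x^q - x\<close> are
    nonzero, this contradicts \<open>sep\<close>.\<close>
  have t0: "t = 0"
  proof (rule ccontr)
    assume t: "t \<noteq> 0"
    have "of_nat n * f ^ Suc s = 0"
      using arg_cong[OF R, of "\<lambda>P. Polynomial.coeff P t"] t
      by (simp add: R_def coeff_pCons split: nat.splits)
    then have n0: "of_nat n = (0 :: 'k poly)"
      using f by simp
    have "of_nat n * f + w = 0"
      using arg_cong[OF R, of "\<lambda>P. Polynomial.coeff P 0"] t
      by (simp add: R_def neg_eq_iff_add_eq_0)
    then have "pderiv f = 0"
      using x by (simp add: n0 w_def)
    then show False
      using sep n0 by (simp add: of_nat_poly)
  qed
  then show "n dvd q - 1"
    using qnt by simp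
  have "of_nat n * f ^ Suc s = of_nat n * f + w"
    using arg_cong[OF R, of "\<lambda>P. Polynomial.coeff P 0"] t0 by (simp add: R_def)
  then show "of_nat n * f * (f ^ ((q - 1) div n) - 1) = ([:0, 1:] ^ q - [:0, 1:]) * pderiv f"
    unfolding s_def[symmetric] by (simp add: w_def algebra_simps)
qed

text \<open>The identity turns the derivation into a combination of \<open>(y^n)^m - f^m\<close> for
  \<open>m = s + 1\<close> and \<open>m = 1\<close>.\<close>

lemma superelliptic_dvd_Frobenius_derivationI:
  fixes f :: "'k::idom poly"
  assumes n: "n \<ge> 1" and q: "q > 1" and dvd: "n dvd q - 1"
    and eq: "of_nat n * f * (f ^ ((q - 1) div n) - 1) = ([:0, 1:] ^ q - [:0, 1:]) * pderiv f"
  shows "superelliptic n f dvd Frobenius_derivation q (superelliptic n f)"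
proof -
  define s where "s = (q - 1) div n"
  have "var_y ^ n * var_y ^ (q - 1) = (var_y ^ n) ^ Suc s * (1 :: 'k poly poly)"
    using dvd by (simp add: s_def flip: power_mult)
  moreover have "[:([:0, 1:] ^ q - [:0, 1:]) * pderiv f:] =
      of_nat n * ([:f:] ^ Suc s - [:f:] ^ 1)"
    unfolding eq[symmetric] s_def[symmetric]
    by (simp add: of_nat_poly poly_const_pow algebra_simps)
  ultimately have "Frobenius_derivation q (superelliptic n f) =
      of_nat n * (((var_y ^ n) ^ Suc s - [:f:] ^ Suc s) - ((var_y ^ n) ^ 1 - [:f:] ^ 1))"
    using Frobenius_derivation_superelliptic[OF n, of q f] q
    by (simp only: less_imp_le power_one_right mult_1_right) (simp only: algebra_simps)
  then show ?thesis
    by (metis dvd_mult dvd_diff superelliptic_dvd_power_diff)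
qed

section \<open>Simple zeros on a line \<open>x = a\<close>\<close>

text \<open>A common zero \<open>(a, b)\<close> of \<open>A\<close> and \<open>B\<close> also kills
  the \<open>y\<close>-derivative \<open>n y^(n-1)\<close>; hence \<open>b = 0\<close>, and
  \<open>b^n = f(a)\<close> forces \<open>f(a) = 0\<close>.\<close>

lemma superelliptic_simple_zero:
  fixes f :: "'k::field poly"
  assumes n: "of_nat n \<noteq> (0 :: 'k)" and a: "poly f a \<noteq> 0"
    and dvd: "A * B dvd superelliptic n f"
    and A: "poly (poly A [:b:]) a = 0" and B: "poly (poly B [:b:]) a = 0"
  shows False
proof -
  obtain C where C: "superelliptic n f = A * B * C"
    using dvd by (elim dvdE)
  have "poly (poly (superelliptic n f) [:b:]) a = 0"
    using A by (simp add: C)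
  moreover have "poly (poly (partial_y (superelliptic n f)) [:b:]) a = 0"
    using A B by (simp add: C partial_y_def pderiv_mult)
  moreover have "n > 0"
    using n by (cases n) auto
  ultimately show False
    using n a by (auto simp: zero_power poly_superelliptic partial_y_superelliptic
        var_y_def of_nat_poly)
qed

text \<open>A constant leading coefficient keeps the degree in \<open>y\<close> from dropping at
  \<open>x = a\<close>, so the fibre polynomial is nonconstant and has a root.\<close>

lemma exists_zero_over:
  fixes G :: "'k::alg_closed_field poly poly"
  assumes "is_unit (lead_coeff G)" and "\<not> is_unit G"
  shows "\<exists>b. poly (poly G [:b:]) a = 0"
proof -
  obtain k where k: "lead_coeff G = [:k:]" "k \<noteq> 0"
    using assms(1) by (auto elim!: is_unit_polyE' simp: monom_0)
  have "Polynomial.degree G \<noteq> 0"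
    using assms by (metis is_unit_const_poly_iff degree_eq_zeroE lead_coeff_pCons(2))
  moreover have "Polynomial.degree G \<le> Polynomial.degree (map_poly (\<lambda>c. poly c a) G)"
    using k by (intro le_degree) (simp add: coeff_map_poly)
  ultimately show ?thesis
    using alg_closed_imp_poly_has_root[of "map_poly (\<lambda>c. poly c a) G"]
    by (simp add: poly_map_poly_eval)
qed

lemma is_unit_lead_coeff_of_dvd_monic:
  fixes G F :: "'k::algebraic_semidom poly"
  assumes "G dvd F" "lead_coeff F = 1"
  shows "is_unit (lead_coeff G)"
  using assms by (metis dvdE dvd_triv_left lead_coeff_mult)

text \<open>The Leibniz rule leaves \<open>G | H DG\<close>. If \<open>G\<close> divided its
  cofactor \<open>H\<close>, a zero of \<open>G\<close> over \<open>a\<close> would be a double zero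
  of \<open>y^n - f\<close>.\<close>

lemma irreducible_dvd_Frobenius_derivation:
  fixes f :: "'k::{alg_closed_field, factorial_ring_gcd, semiring_gcd_mult_normalize} poly"
  assumes n: "of_nat n \<noteq> (0 :: 'k)" and a: "poly f a \<noteq> 0"
    and G: "Factorial_Ring.irreducible G" "G dvd superelliptic n f"
    and F: "superelliptic n f dvd Frobenius_derivation q (superelliptic n f)"
  shows "G dvd Frobenius_derivation q G"
proof -
  obtain H where H: "superelliptic n f = G * H"
    using G(2) by (elim dvdE)
  have "G dvd G * Frobenius_derivation q H + H * Frobenius_derivation q G"
    using dvd_trans[OF G(2) F] unfolding H Frobenius_derivation_mult .
  then have "G dvd H * Frobenius_derivation q G"
    by (simp add: dvd_add_right_iff)
  moreover have "prime_elem G"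
    using G(1) by (rule irreducible_imp_prime_elem)
  moreover have "\<not> G dvd H"
  proof
    assume "G dvd H"
    then have "G * G dvd superelliptic n f"
      by (simp add: H)
    moreover have "n \<ge> 1"
      using n by (cases n) auto
    then have "is_unit (lead_coeff G)"
      using is_unit_lead_coeff_of_dvd_monic[OF G(2)] degree_superelliptic by blast
    then obtain b where "poly (poly G [:b:]) a = 0"
      using exists_zero_over G(1) irreducible_not_unit by blast
    ultimately show False
      using superelliptic_simple_zero[OF n a] by blast
  qed
  ultimately show ?thesis
    by (simp add: prime_elem_dvd_mult_iff)
qed


section \<open>Finite fields\<close>

text \<open>Multiplication by a nonzero \<open>x\<close> permutes the nonzero elements; comparing
  their products gives \<open>x^(q-1) = 1\<close>.\<close>

lemma power_CARD_eq_self: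
  fixes x :: "'a::{finite, field}"
  shows "x ^ CARD('a) = x"
proof (cases "x = 0")
  case False
  have inj: "inj ((*) x)"
    using False by (intro injI) simp
  have "(*) x ` (UNIV - {0}) = UNIV - {0}"
    using False by (intro endo_inj_surj) (auto intro: inj_on_subset[OF inj])
  then have "\<Prod>(UNIV - {0}) = (\<Prod>y\<in>UNIV - {0}. x * y)"
    using prod.reindex[OF inj_on_subset[OF inj], of "UNIV - {0}" id] by (simp add: comp_def)
  also have "\<dots> = x ^ (CARD('a) - 1) * \<Prod>(UNIV - {0 :: 'a})"
    by (simp add: prod.distrib)
  finally have "x ^ (CARD('a) - 1) = 1"
    by (simp add: prod_zero_iff)
  then show ?thesis
    using power_minus_mult[of "CARD('a)" x] by simp
qed simp

lemma CARD_field_gt_1: "CARD('a::{finite, field}) > 1"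
  using card_mono[of UNIV "{0, 1 :: 'a}"] by simp

text \<open>\<open>X^q - X\<close> has at most \<open>q\<close> roots, and the \<open>q\<close>
  images of base field elements are such roots already.\<close>

lemma in_range_to_acI:
  fixes z :: "'a::{finite, field} alg_closure"
  assumes "z ^ CARD('a) = z"
  shows "z \<in> range to_ac"
proof -
  define P where "P = Polynomial.monom 1 CARD('a) - [:0, 1 :: 'a alg_closure:]"
  have card: "CARD('a) > 1"
    by (rule CARD_field_gt_1)
  have "Polynomial.coeff P CARD('a) = 1"
    using card by (simp add: P_def coeff_pCons split: nat.split)
  then have P: "P \<noteq> 0"
    by auto
  have roots: "{z. poly P z = 0} = {z. z ^ CARD('a) = z}"
    by (simp add: P_def poly_monom)
  have "card {z. poly P z = 0} \<le> Polynomial.degree P"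
    by (rule card_poly_roots_bound[OF P])
  also have "\<dots> \<le> CARD('a)"
    unfolding P_def using card by (intro degree_diff_le) (auto simp: degree_monom_le)
  also have "\<dots> = card (range (to_ac :: 'a \<Rightarrow> _))"
    by (simp add: card_image inj_to_ac)
  finally have "range to_ac = {z. poly P z = 0}"
    unfolding roots using poly_roots_finite[OF P]
    by (intro card_seteq) (auto simp: roots power_CARD_eq_self simp flip: to_ac_power)
  then show ?thesis
    using assms roots by auto
qed

lemma CHAR_eq_of_CARD_prime_power:
  assumes "Factorial_Ring.prime p" and "CARD('a::{finite, field}) = p ^ r"
  shows "CHAR('a) = p"
proof -
  have "Factorial_Ring.prime CHAR('a)"
    by (rule prime_CHAR_semidom) (simp add: finite_imp_CHAR_pos)
  then show ?thesis
    using CHAR_dvd_CARD[where ?'a = 'a] assms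
    by (metis prime_dvd_power primes_dvd_imp_eq)
qed

text \<open>Additivity is the freshman's dream, as \<open>q\<close> is a power of the
  characteristic.\<close>

lemma Frobenius_ring_map:
  assumes "Factorial_Ring.prime p" and "CARD('a::{finite, field}) = p ^ r"
  shows "ring_map (\<lambda>z :: 'a alg_closure. z ^ CARD('a))"
proof
  have "CHAR('a alg_closure) = p"
    using CHAR_eq_of_CARD_prime_power[OF assms] by simp
  then show "(x + y) ^ CARD('a) = x ^ CARD('a) + y ^ CARD('a)" for x y :: "'a alg_closure"
    using assms by (intro freshmans_dream') auto
qed (simp_all add: power_mult_distrib)

section \<open>Vanishing derivatives in characteristic \<open>p\<close>\<close>

lemma pderiv_eq_0_imp_pcompose:
  fixes f :: "'k::field poly"
  assumes "pderiv f = 0" and p: "CHAR('k) = p" "p > 0"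
  obtains g where "f = pcompose g (Polynomial.monom 1 p)"
proof
  \<comment> \<open>The term of degree \<open>j\<close> of \<open>f\<close> with its exponent
    divided by \<open>p\<close>; coefficients stay as they are, since the target is
    \<open>g(x^p)\<close> and not \<open>g(x)^p\<close>.\<close>
  let ?h = "\<lambda>j. if p dvd j then Polynomial.monom (Polynomial.coeff f j) (j div p) else 0"
  have zero: "Polynomial.coeff f j = 0" if j: "\<not> p dvd j" for j
  proof -
    obtain i where "j = Suc i"
      using j by (cases j) auto
    then have "of_nat j * Polynomial.coeff f j = 0"
      using assms(1) by (metis coeff_0 coeff_pderiv)
    then show ?thesis
      using j p by (simp add: of_nat_eq_0_iff_char_dvd)
  qed
  have "pcompose (?h j) (Polynomial.monom 1 p) = Polynomial.monom (Polynomial.coeff f j) j" for j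
    using zero[of j] p
    by (auto simp: monom_altdef[of _ "j div p"] pcompose_smult
        ring_map.map_power[OF pcompose_ring_map] pcompose_pCons
        Polynomial.smult_monom monom_power)
  then show "f = pcompose (\<Sum>j\<le>Polynomial.degree f. ?h j) (Polynomial.monom 1 p)"
    unfolding pcompose_sum using poly_as_sum_of_monoms[of f] by simp
qed

text \<open>With \<open>n = p m\<close> and \<open>f = g(x^p)\<close>, the polynomial arises from
  \<open>y^m - g\<close> by substituting \<open>x^p\<close> and \<open>y^p\<close>. This identifies
  the case excluded in the theorem.\<close>

lemma superelliptic_in_powers_subring:
  fixes f :: "'k::field poly"
  assumes p: "CHAR('k) = p" "p > 0" and "of_nat n = (0 :: 'k)" "pderiv f = 0"
  shows "superelliptic n f \<in> powers_subring p"
proof -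
  obtain m where m: "n = p * m"
    using assms(1,3) by (auto simp: of_nat_eq_0_iff_char_dvd)
  obtain g where g: "f = pcompose g (Polynomial.monom 1 p)"
    using pderiv_eq_0_imp_pcompose[OF assms(4) p] .
  interpret x: ring_map "\<lambda>c :: 'k poly. pcompose c (Polynomial.monom 1 p)"
    by (rule pcompose_ring_map)
  interpret xx: ring_map "map_poly (\<lambda>c :: 'k poly. pcompose c (Polynomial.monom 1 p))"
    by (rule x.map_poly_ring_map)
  interpret y: ring_map "\<lambda>c :: 'k poly poly. pcompose c (Polynomial.monom 1 p)"
    by (rule pcompose_ring_map)
  have "map_poly (\<lambda>c. pcompose c (Polynomial.monom 1 p)) (superelliptic m g) = var_y ^ m - [:f:]"
    by (simp add: superelliptic_def xx.map_diff var_y_power map_poly_monom x.map_zero x.map_one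
        map_poly_pCons g)
  moreover have "pcompose var_y (Polynomial.monom 1 p) = (var_y ^ p :: 'k poly poly)"
    by (simp add: var_y_def pcompose_pCons monom_altdef)
  then have "pcompose (var_y ^ m - [:f:]) (Polynomial.monom 1 p) = superelliptic n f"
    by (simp only: superelliptic_def y.map_diff y.map_power m power_mult pcompose_const)
  ultimately have "superelliptic n f =
    pcompose (map_poly (\<lambda>c. pcompose c (Polynomial.monom 1 p)) (superelliptic m g))
      (Polynomial.monom 1 p)"
    by simp
  then show ?thesis
    unfolding powers_subring_def by blast
qed

section \<open>Components are defined over the base field\<close>

text \<open>Compare degrees in the identity: with \<open>m = deg f\<close> and
  \<open>q - 1 = n s\<close>, the left side has degree \<open>m + m s\<close>, the right side at
  most \<open>q + m - 1\<close>.\<close>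

lemma degree_le_of_Frobenius_identity:
  fixes f :: "'k::field poly"
  assumes n: "of_nat n \<noteq> (0 :: 'k)" and q: "q > 1" and dvd: "n dvd q - 1"
    and f: "Polynomial.degree f > 0"
    and eq: "of_nat n * f * (f ^ ((q - 1) div n) - 1) = ([:0, 1:] ^ q - [:0, 1:]) * pderiv f"
  shows "Polynomial.degree f \<le> n"
proof -
  define s m where "s = (q - 1) div n" and "m = Polynomial.degree f"
  have qs: "q - 1 = n * s"
    using dvd by (simp add: s_def)
  then have s: "s > 0"
    using q by (cases s) auto
  have "Polynomial.degree (f ^ s - 1) = m * s"
  proof -
    have "Polynomial.degree (f ^ s) = m * s"
      using f by (subst degree_power_eq) (auto simp: m_def)
    then show ?thesis
      using f s degree_add_eq_left[of "- 1" "f ^ s"] by (simp add: m_def)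
  qed
  moreover have "f ^ s - 1 \<noteq> 0"
    using calculation f s by (auto simp: m_def)
  ultimately have "m + m * s = Polynomial.degree (of_nat n * f * (f ^ s - 1))"
    using n f by (subst degree_mult_eq) (auto simp: m_def of_nat_poly)
  also have "\<dots> = Polynomial.degree (([:0, 1:] ^ q - [:0, 1:]) * pderiv f)"
    using eq by (simp add: s_def)
  also have "\<dots> \<le> Polynomial.degree ([:0, 1:] ^ q - [:0, 1 :: 'k:]) + Polynomial.degree (pderiv f)"
    by (rule degree_mult_le)
  also have "\<dots> \<le> q + (m - 1)"
  proof (rule add_mono)
    show "Polynomial.degree ([:0, 1:] ^ q - [:0, 1 :: 'k:]) \<le> q"
      using q degree_linear_power[of "0 :: 'k" q] by (intro degree_diff_le) auto
    show "Polynomial.degree (pderiv f) \<le> m - 1"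
      by (intro degree_le) (auto simp: coeff_pderiv m_def coeff_eq_0)
  qed
  finally have "m + m * s \<le> q + (m - 1)" .
  moreover have "m > 0"
    using f by (simp add: m_def)
  ultimately have "m * s \<le> n * s"
    unfolding qs[symmetric] using q by linarith
  then show ?thesis
    using s by (simp add: m_def)
qed

text \<open>Since \<open>deg f <= n < q\<close>, some \<open>a\<close> in the base field is not a
  root; there \<open>a^q - a = 0\<close> annihilates the right side of the identity.\<close>

lemma exists_nonzero_value:
  fixes f :: "'a::{finite, field} poly"
  assumes n: "of_nat n \<noteq> (0 :: 'a)" and dvd: "n dvd CARD('a) - 1"
    and f: "Polynomial.degree f > 0"
    and eq: "of_nat n * f * (f ^ ((CARD('a) - 1) div n) - 1) =
      ([:0, 1:] ^ CARD('a) - [:0, 1:]) * pderiv f"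
  shows "\<exists>a. poly f a \<noteq> 0 \<and> poly f a ^ ((CARD('a) - 1) div n) = 1"
proof -
  have q: "CARD('a) > 1"
    by (rule CARD_field_gt_1)
  have "Polynomial.degree f \<le> n"
    by (rule degree_le_of_Frobenius_identity[OF n q dvd f eq])
  also have "n < CARD('a)"
    using dvd q by (auto dest: dvd_imp_le)
  finally have "Polynomial.degree f < CARD('a)" .
  moreover have "card {a. poly f a = 0} \<le> Polynomial.degree f"
    by (rule card_poly_roots_bound) (use f in auto)
  ultimately have "{a. poly f a = 0} \<noteq> UNIV"
    by auto
  then obtain a where a: "poly f a \<noteq> 0"
    by blast
  have "poly (of_nat n * f * (f ^ ((CARD('a) - 1) div n) - 1)) a = 0"
    unfolding eq by (simp add: power_CARD_eq_self)
  then have "poly f a ^ ((CARD('a) - 1) div n) = 1"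
    using n a by (simp add: of_nat_poly)
  with a show ?thesis
    by blast
qed

text \<open>A monic multiple \<open>M\<close> of \<open>G\<close> is shown to equal its Frobenius
  conjugate, so its coefficients satisfy \<open>z^q = z\<close> and lie in the base field.\<close>

lemma defined_over_base_component:
  fixes f :: "'a::{finite, field} poly" and n :: nat
  defines "s \<equiv> (CARD('a) - 1) div n"
  assumes p: "Factorial_Ring.prime p" "CARD('a) = p ^ r"
    and n: "of_nat n \<noteq> (0 :: 'a)" and dvd: "n dvd CARD('a) - 1"
    and a: "poly f a \<noteq> 0" "poly f a ^ s = 1"
    and G: "Factorial_Ring.irreducible G" "G dvd to_closure (superelliptic n f)"
  shows "defined_over_base G"
proof -
  define \<sigma> where "\<sigma> = (\<lambda>z :: 'a alg_closure. z ^ CARD('a))"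
  let ?\<phi> = "map_poly (map_poly \<sigma>)"
  interpret \<sigma>: ring_map \<sigma>
    unfolding \<sigma>_def by (rule Frobenius_ring_map[OF p])
  interpret \<sigma>x: ring_map "map_poly \<sigma>"
    by (rule \<sigma>.map_poly_ring_map)
  interpret \<sigma>xy: ring_map ?\<phi>
    by (rule \<sigma>x.map_poly_ring_map)
  interpret ac: ring_map "to_ac :: 'a \<Rightarrow> _"
    by (rule to_ac_ring_map)
  define F where "F = superelliptic n (map_poly to_ac f)"
  have F: "to_closure (superelliptic n f) = F"
    unfolding to_closure_def F_def by (rule map_poly_superelliptic[OF to_ac_ring_map])
  have n1: "n \<ge> 1"
    using n by (cases n) auto
  have f_a: "poly (map_poly to_ac f) (to_ac a) = to_ac (poly f a)"
    by (rule ac.poly_map_poly)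
  have G_dvd: "G dvd superelliptic n (map_poly to_ac f)"
    using G(2) by (simp add: F F_def)
  have "is_unit (lead_coeff G)"
    by (rule is_unit_lead_coeff_of_dvd_monic[OF G_dvd degree_superelliptic(2)[OF n1]])
  then obtain k where k: "lead_coeff G = [:k:]" "k \<noteq> 0"
    by (auto elim!: is_unit_polyE' simp: monom_0)
  \<comment> \<open>Being monic in \<open>y\<close> fixes the scalar, so that \<open>M\<close>
    dividing its conjugate will force equality.\<close>
  define M where "M = Polynomial.smult [:inverse k:] G"
  have M_eq: "M = [:[:inverse k:]:] * G"
    by (simp add: M_def)
  have M_unit: "is_unit [:[:inverse k:]:]"
    using k by (simp add: is_unit_const_poly_iff is_unit_pCons_iff)
  have M_lead: "lead_coeff M = 1"
    using k by (simp add: M_def one_pCons)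
  have "M dvd F"
    unfolding F_def M_eq mult_unit_dvd_iff'[OF M_unit] by (rule G_dvd)
  then obtain N where N: "F = M * N"
    by (elim dvdE)
  have M_irred: "Factorial_Ring.irreducible M"
    unfolding M_eq irreducible_mult_unit_left[OF M_unit] by (rule G(1))
  have "?\<phi> F = F"
  proof -
    have "map_poly \<sigma> (map_poly to_ac f) = map_poly to_ac f"
      by (intro poly_eqI)
        (simp add: coeff_map_poly \<sigma>.map_zero \<sigma>_def power_CARD_eq_self flip: to_ac_power)
    then show ?thesis
      unfolding F_def by (simp add: map_poly_superelliptic[OF \<sigma>.ring_map_axioms])
  qed
  then have \<phi>: "F = ?\<phi> M * ?\<phi> N"
    by (metis N \<sigma>xy.map_mult)
  have "\<not> M dvd ?\<phi> N"
  proof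
    assume "M dvd ?\<phi> N"
    then have dvdF: "?\<phi> M * M dvd superelliptic n (map_poly to_ac f)"
      using \<phi> by (auto simp: F_def intro: mult_dvd_mono)
    have "\<not> is_unit M"
      using M_irred irreducible_not_unit by blast
    then obtain b where b: "poly (poly M [:b:]) (to_ac a) = 0"
      using exists_zero_over[of M "to_ac a"] M_lead by auto
    have "poly (poly F [:b:]) (to_ac a) = 0"
      by (simp add: N b)
    then have "b ^ n = to_ac (poly f a)"
      by (simp add: F_def poly_superelliptic f_a)
    \<comment> \<open>Here \<open>f(a)^s = 1\<close> enters; since \<open>n s = q - 1\<close>, it
      puts \<open>b\<close> among the fixed points of \<open>\<sigma>\<close>.\<close>
    then have "b ^ (n * s) = 1"
      using a(2) by (simp add: power_mult flip: to_ac_power)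
    then have "b ^ (CARD('a) - 1) = 1"
      using dvd by (simp add: s_def)
    then have \<sigma>b: "\<sigma> b = b"
      using power_minus_mult[of "CARD('a)" b] by (simp add: \<sigma>_def)
    have \<sigma>a: "\<sigma> (to_ac a) = to_ac a"
      by (simp add: \<sigma>_def power_CARD_eq_self flip: to_ac_power)
    \<comment> \<open>The conjugate of \<open>M\<close> takes the value
      \<open>\<sigma>(M(a, b))\<close> at \<open>(\<sigma> a, \<sigma> b) = (a, b)\<close>.\<close>
    have "poly (poly (?\<phi> M) [:b:]) (to_ac a) = 0"
      using \<sigma>x.poly_map_poly[of M "[:b:]"] \<sigma>.poly_map_poly[of "poly M [:b:]" "to_ac a"] b
      by (simp add: map_poly_pCons \<sigma>.map_zero \<sigma>a \<sigma>b)
    moreover have "of_nat n \<noteq> (0 :: 'a alg_closure)"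
      using n by (metis to_ac_eq_0_iff to_ac_of_nat)
    ultimately show False
      using superelliptic_simple_zero[OF _ _ dvdF _ b] a(1) f_a by auto
  qed
  moreover have "M dvd ?\<phi> M * ?\<phi> N"
    using N \<phi> by (metis dvd_triv_left)
  ultimately have M_dvd: "M dvd ?\<phi> M"
    using irreducible_imp_prime_elem[OF M_irred] by (simp add: prime_elem_dvd_mult_iff)
  have \<phi>M_lead: "lead_coeff (?\<phi> M) = 1"
    using M_lead by (subst lead_coeff_map_poly_nz) (simp_all add: \<sigma>.map_one \<sigma>x.map_zero)
  \<comment> \<open>Equal degrees in \<open>y\<close> make the quotient \<open>K\<close> constant in
    \<open>y\<close>, and monicity makes it 1.\<close>
  have "Polynomial.degree (?\<phi> M) = Polynomial.degree M"
    by (rule map_poly_degree_eq) (simp add: M_lead \<sigma>.map_one)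
  moreover obtain K where K: "?\<phi> M = M * K"
    using M_dvd by (elim dvdE)
  moreover have "lead_coeff K = 1"
    using \<phi>M_lead M_lead unfolding K lead_coeff_mult by simp
  moreover have "M \<noteq> 0" "K \<noteq> 0"
    using M_lead \<open>lead_coeff K = 1\<close> by auto
  ultimately have "K = 1"
    by (auto simp: degree_mult_eq one_pCons elim!: degree_eq_zeroE)
  with K have "?\<phi> M = M"
    by simp
  then have fixed: "\<sigma> (Polynomial.coeff (Polynomial.coeff M i) j) =
      Polynomial.coeff (Polynomial.coeff M i) j" for i j
    by (metis \<sigma>.map_zero \<sigma>x.map_zero coeff_map_poly)
  have "M = to_closure (map_poly (map_poly of_ac) M)"
    unfolding to_closure_def
    using fixed by (intro poly_eqI)
      (simp add: coeff_map_poly to_ac_of_ac in_range_to_acI \<sigma>_def)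
  then show ?thesis
    unfolding defined_over_base_def M_def using k
    by (intro exI[of _ "inverse k"]) auto
qed

section \<open>Descent of the identity and the equivalence\<close>

text \<open>Coefficientwise \<open>to_ac\<close> is an injective ring homomorphism commuting with
  \<open>pderiv\<close>.\<close>

lemma Frobenius_identity_to_closure:
  fixes f :: "'a::field poly"
  shows "of_nat n * map_poly to_ac f * (map_poly to_ac f ^ s - 1) =
      ([:0, 1:] ^ q - [:0, 1:]) * pderiv (map_poly to_ac f) \<longleftrightarrow>
    of_nat n * f * (f ^ s - 1) = ([:0, 1:] ^ q - [:0, 1:]) * pderiv f"
    (is "?L \<longleftrightarrow> ?R")
proof -
  interpret ac: ring_map "to_ac :: 'a \<Rightarrow> _"
    by (rule to_ac_ring_map)
  interpret ring_map "map_poly (to_ac :: 'a \<Rightarrow> _)"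
    by (rule ac.map_poly_ring_map)
  have inj: "map_poly to_ac P = map_poly to_ac Q \<longleftrightarrow> P = Q" for P Q :: "'a poly"
    by (simp add: poly_eq_iff coeff_map_poly)
  have pderiv: "pderiv (map_poly to_ac f) = map_poly to_ac (pderiv f)"
    by (intro poly_eqI) (simp add: coeff_map_poly coeff_pderiv)
  have "map_poly to_ac [:0, 1 :: 'a:] = [:0, 1:]"
    by (simp add: map_poly_pCons)
  then show ?thesis
    unfolding pderiv inj[symmetric]
    by (simp add: map_mult map_diff map_power map_of_nat map_one)
qed

theorem theorem5p3:
  fixes f :: "'a::{finite, field} poly" and p q n :: nat
  assumes "Factorial_Ring.prime p" and "\<exists>r\<ge>1. q = p ^ r" and "CARD('a) = q"
    and "Polynomial.degree f > 0"
    and "n \<ge> 1"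
    and "superelliptic n f \<notin> powers_subring p"
  shows "(\<forall>G \<in> irreducible_components (to_closure (superelliptic n f)). Frobenius_nonclassical G)
     \<longleftrightarrow> n dvd q - 1 \<and>
         of_nat n * f * (f ^ ((q - 1) div n) - 1) = ([:0, 1:] ^ q - [:0, 1:]) * pderiv f"
proof -
  obtain r where r: "CARD('a) = p ^ r"
    using assms(2,3) by auto
  have CHAR: "CHAR('a) = p"
    by (rule CHAR_eq_of_CARD_prime_power[OF assms(1) r])
  have p: "p > 0"
    using assms(1) prime_gt_0_nat by blast
  have q: "q > 1"
    using CARD_field_gt_1[where ?'a = 'a] assms(3) by simp
  let ?f = "map_poly to_ac f"
  have F: "to_closure (superelliptic n f) = superelliptic n ?f"
    unfolding to_closure_def by (rule map_poly_superelliptic[OF to_ac_ring_map])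
  have of_nat_iff: "of_nat n = (0 :: 'a alg_closure) \<longleftrightarrow> of_nat n = (0 :: 'a)"
    using to_ac_eq_0_iff[of "of_nat n :: 'a"] by (simp del: to_ac_eq_0_iff)
  show ?thesis
  proof (intro iffI conjI ballI; (elim conjE)?)
    assume "\<forall>G \<in> irreducible_components (to_closure (superelliptic n f)). Frobenius_nonclassical G"
    then have "superelliptic n ?f dvd Frobenius_derivation q (superelliptic n ?f)"
      unfolding F irreducible_components_def Frobenius_nonclassical_def assms(3)
      by - (rule dvd_Frobenius_derivation, auto simp: Frobenius_derivation_def)
    moreover have "?f \<noteq> 0"
      using assms(4) by (auto simp: map_poly_eq_0_iff)
    \<comment> \<open>If both vanished, \<open>y^n - f\<close> would lie in the subring excluded by
      hypothesis.\<close>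
    moreover have "of_nat n \<noteq> (0 :: 'a alg_closure) \<or> pderiv ?f \<noteq> 0"
    proof -
      have "pderiv ?f = map_poly to_ac (pderiv f)"
        by (intro poly_eqI) (simp add: coeff_map_poly coeff_pderiv)
      then show ?thesis
        using superelliptic_in_powers_subring[OF CHAR p] assms(6) of_nat_iff
        by (auto simp: map_poly_eq_0_iff)
    qed
    ultimately show "n dvd q - 1"
      and "of_nat n * f * (f ^ ((q - 1) div n) - 1) = ([:0, 1:] ^ q - [:0, 1:]) * pderiv f"
      using superelliptic_dvd_Frobenius_derivationD[OF assms(5) q, of ?f]
      unfolding Frobenius_identity_to_closure by blast+
  next
    fix G
    assume dvd: "n dvd q - 1"
      and eq: "of_nat n * f * (f ^ ((q - 1) div n) - 1) = ([:0, 1:] ^ q - [:0, 1:]) * pderiv f"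
      and "G \<in> irreducible_components (to_closure (superelliptic n f))"
    then have G: "Factorial_Ring.irreducible G" "G dvd to_closure (superelliptic n f)"
      by (simp_all add: irreducible_components_def)
    \<comment> \<open>Otherwise \<open>p | n | q - 1\<close>, while \<open>p | q\<close>.\<close>
    have n: "of_nat n \<noteq> (0 :: 'a)"
    proof
      assume "of_nat n = (0 :: 'a)"
      then have "p dvd q - 1"
        using dvd CHAR by (metis dvd_trans of_nat_eq_0_iff_char_dvd)
      moreover have "p dvd q"
        using assms(2) by (auto simp: dvd_power)
      ultimately have "p dvd 1"
        using q by (metis dvd_diffD1 less_imp_le)
      then show False
        using assms(1) not_prime_unit by blast
    qed
    obtain a where a: "poly f a \<noteq> 0" "poly f a ^ ((CARD('a) - 1) div n) = 1"
      using exists_nonzero_value[OF n _ assms(4), unfolded assms(3), OF dvd eq]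
      unfolding assms(3) by blast
    have "superelliptic n ?f dvd Frobenius_derivation q (superelliptic n ?f)"
      by (rule superelliptic_dvd_Frobenius_derivationI[OF assms(5) q dvd
            Frobenius_identity_to_closure[THEN iffD2, OF eq]])
    moreover have "poly ?f (to_ac a) \<noteq> 0"
      using a(1) by (simp add: ring_map.poly_map_poly[OF to_ac_ring_map])
    ultimately have "G dvd Frobenius_derivation q G"
      using irreducible_dvd_Frobenius_derivation[of n ?f "to_ac a" G q] G n
      unfolding F of_nat_iff by blast
    moreover have "defined_over_base G"
      by (rule defined_over_base_component[OF assms(1) r n _ a G]) (use dvd assms(3) in simp)
    ultimately show "Frobenius_nonclassical G"
      using G(1) by (simp add: Frobenius_nonclassical_def Frobenius_derivation_def assms(3))
  qed
qed

end
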